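(* Assume that computing a single stochastic gradient takes at most $h$ seconds and that communicating vectors among the workers takes at most $\tau$ seconds. Let $f:\mathbb{R}^d\to\mathbb{R}$ be differentiable and $L$-smooth, i.e. $\|\nabla f(x)-\nabla f(y)\|\le L\|x-y\|$ for all $x,y\in\mathbb{R}^d$; let $f$ be convex and attain its minimum, with $B=\|x^0-x^*\|$, where $x^*$ is the minimizer closest to the starting point $x^0$; and let the stochastic gradients satisfy $\mathbb{E}_{\xi}[\nabla f(x;\xi)]=\nabla f(x)$ and $\mathbb{E}_{\xi}[\|\nabla f(x;\xi)-\nabla f(x)\|^2]\le\sigma^2$ for all $x\in\mathbb{R}^d$, where $\sigma^2\ge 0$. Then the (worst-case) time complexity of canonical Local SGD to find an $\varepsilon$-solution is not better than $$\min\left\{\sqrt{\tau h\left(\frac{L\sigma^2B^4}{\varepsilon^3}\right)}+h\left(\frac{LB^2}{\varepsilon}+\frac{\sigma^2B^2}{n\varepsilon^2}\right),\; h\left(\frac{LB^2}{\varepsilon}+\frac{\sigma^2B^2}{\varepsilon^2}\right)\right\}$$ for any choice of the input parameters of the method (local step size $\eta_\ell$, number of communication rounds $R$, number of local steps $K$), up to constant factors.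
   Context: Homogeneous distributed setting: $n$ workers minimize $f(x)=\mathbb{E}_{\xi\sim\mathcal D}[f(x;\xi)]$, and every worker can sample stochastic gradients $\nabla f(x;\xi)$, $\xi\sim\mathcal D$. Canonical Local SGD (starting point $x^0$, local step size $\eta_\ell$, $R$ communication rounds, $K$ local steps): for $t=0,\dots,R-1$, each worker $i\in\{1,\dots,n\}$ in parallel sets $z^t_{i,0}=x^t$ and performs $z^t_{i,j+1}=z^t_{i,j}-\eta_\ell\nabla f(z^t_{i,j};\xi^t_{i,j})$, $\xi^t_{i,j}\sim\mathcal D$, for $j=0,\dots,K-1$; then $x^{t+1}=\frac1n\sum_{i=1}^n z^t_{i,K}$. Time complexity: $R$ communication rounds with $K$ local steps each (performed by the workers in parallel) are charged $\tau R+hKR$ seconds. An $\varepsilon$-solution is a (possibly random) point $\bar x\in\mathbb{R}^d$ with $\mathbb{E}[f(\bar x)]-f(x^* )\le\varepsilon$. "Up to constant factors" means up to positive universal constants.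
   Formalization: The formal theorem assumes ε ≤ LB²/4 and at least two local steps (K ≥ 2): for ε ≥ LB²/2 the starting point already is an ε-solution, and for K = 1 (minibatch SGD) with many workers the stated bound fails. *)

theory Defs
  imports "HOL-Probability.Probability"
begin

text \<open>
  The problem class. \<open>F x \<xi>\<close> is the sample loss $f(x;\xi)$ and \<open>G x \<xi>\<close> the stochastic gradient
  $\nabla f(x;\xi)$; \<open>gradf\<close> is the gradient of the expected loss \<open>f\<close>, and \<open>D\<close> is the distribution
  of the samples. Integrability is required explicitly because the Bochner integral of a
  non-integrable function is 0.
\<close>

locale stochastic_convex_problem = prob_space D
  for D :: "'xi measure" +
  fixes L B \<sigma> :: real
    and f :: "'a::euclidean_space \<Rightarrow> real"
    and gradf :: "'a \<Rightarrow> 'a"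
    and F :: "'a \<Rightarrow> 'xi \<Rightarrow> real"
    and G :: "'a \<Rightarrow> 'xi \<Rightarrow> 'a"
    and x0 xstar :: 'a
  assumes gradient: "\<And>x. GDERIV f x :> gradf x"
    and smooth: "\<And>x y. norm (gradf x - gradf y) \<le> L * norm (x - y)"
    and convex: "convex_on UNIV f"
    and minimizer: "\<And>y. f xstar \<le> f y"
    and closest: "\<And>y. (\<And>z. f y \<le> f z) \<Longrightarrow> norm (x0 - xstar) \<le> norm (x0 - y)"
    and distance: "B = norm (x0 - xstar)"
    and sample_integrable: "\<And>x. integrable D (F x)"
    and sample_mean: "\<And>x. f x = (\<integral>\<xi>. F x \<xi> \<partial>D)"
    and sample_gradient: "\<And>x \<xi>. \<xi> \<in> space D \<Longrightarrow> GDERIV (\<lambda>y. F y \<xi>) x :> G x \<xi>"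
    and oracle_measurable: "(\<lambda>(x, \<xi>). G x \<xi>) \<in> borel_measurable (borel \<Otimes>\<^sub>M D)"
    and oracle_integrable: "\<And>x. integrable D (G x)"
    and unbiased: "\<And>x. (\<integral>\<xi>. G x \<xi> \<partial>D) = gradf x"
    and variance_integrable: "\<And>x. integrable D (\<lambda>\<xi>. (norm (G x \<xi> - gradf x))\<^sup>2)"
    and variance_bound: "\<And>x. (\<integral>\<xi>. (norm (G x \<xi> - gradf x))\<^sup>2 \<partial>D) \<le> \<sigma>\<^sup>2"

text \<open>Local steps of one worker in one round; \<open>s j\<close> is the sample used in step \<open>j\<close>.\<close>

primrec local_steps ::
  "('a::real_vector \<Rightarrow> 'xi \<Rightarrow> 'a) \<Rightarrow> real \<Rightarrow> (nat \<Rightarrow> 'xi) \<Rightarrow> 'a \<Rightarrow> nat \<Rightarrow> 'a" where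
  "local_steps G \<eta> s x 0 = x"
| "local_steps G \<eta> s x (Suc j) =
     local_steps G \<eta> s x j - \<eta> *\<^sub>R G (local_steps G \<eta> s x j) (s j)"

text \<open>
  The point $x^t$ of Local SGD with \<open>n\<close> workers and \<open>K\<close> local steps; \<open>\<omega> (t, i, j)\<close> is the sample
  drawn by worker \<open>i < n\<close> in local step \<open>j < K\<close> of round \<open>t\<close>.
\<close>

primrec local_sgd ::
  "('a::real_vector \<Rightarrow> 'xi \<Rightarrow> 'a) \<Rightarrow> nat \<Rightarrow> real \<Rightarrow> nat \<Rightarrow> 'a
     \<Rightarrow> (nat \<times> nat \<times> nat \<Rightarrow> 'xi) \<Rightarrow> nat \<Rightarrow> 'a" where
  "local_sgd G n \<eta> K x0 \<omega> 0 = x0"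
| "local_sgd G n \<eta> K x0 \<omega> (Suc t) =
     (1 / real n) *\<^sub>R
       (\<Sum>i<n. local_steps G \<eta> (\<lambda>j. \<omega> (t, i, j)) (local_sgd G n \<eta> K x0 \<omega> t) K)"

definition sample_space :: "'xi measure \<Rightarrow> (nat \<times> nat \<times> nat \<Rightarrow> 'xi) measure" where
  "sample_space D = Pi\<^sub>M UNIV (\<lambda>_. D)"

definition eps_solution ::
  "'w measure \<Rightarrow> ('a \<Rightarrow> real) \<Rightarrow> 'a \<Rightarrow> real \<Rightarrow> ('w \<Rightarrow> 'a) \<Rightarrow> bool" where
  "eps_solution M f xstar \<epsilon> X \<longleftrightarrow>
     integrable M (\<lambda>\<omega>. f (X \<omega>)) \<and> (\<integral>\<omega>. f (X \<omega>) \<partial>M) - f xstar \<le> \<epsilon>"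

definition local_sgd_time :: "real \<Rightarrow> real \<Rightarrow> nat \<Rightarrow> nat \<Rightarrow> real" where
  "local_sgd_time \<tau> h R K = \<tau> * real R + h * real K * real R"

end

theory Submission
  imports Defs
begin

text \<open>
  Fix the step size and write $N = KR$. Local SGD has to succeed on every problem of the class, so
  each hard instance that it solves yields an inequality for $\eta$, and these inequalities
  together bound the time. All instances are functions of one coordinate
  $s = x \cdot e$ with starting point $B e$ and minimizer $0$: the gradient is \<open>slope a b s\<close>, with curvature \<open>a\<close>
  to the left and \<open>b \<le> a\<close> to the right of the origin. The noise is a multiple of the sign of a
  three-valued sample, which is nonzero with probability \<open>p\<close>.

  With \<open>a = b\<close> the recursion is linear and the second moment of the iterate obeys an exact affine
  recursion (\<open>second_moment_quadratic\<close>). Curvature $L$ forces $\eta L < 2$, as larger steps do not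
  contract. Curvature $4\varepsilon/B^2$ forces
  $\eta N \ge B^2/(16\varepsilon)$, as otherwise the iterate is still far away, and
  $\eta\sigma^2 \le 8n\varepsilon$, as otherwise the averaged noise alone is too costly.

  The remaining inequality expresses the bias of local steps. With $a = L/2$ and $b = L/4$ a sample
  that throws a worker to the left of the origin is undone faster than one that throws it to the
  right, so the expectation of every worker drifts to the right. Averaging over workers does not
  change an expectation, so the drift does not depend on $n$. The noise is chosen rare and large:
  with $p = \max(\eta L/2, 1/K)$ there is about one jump, of length
  $\eta\sigma/\sqrt{p}$, per round, or per
  $1/(\eta L)$ steps if that is less, and the expectation of the
  final point is at least a constant times this length (\<open>mean_drift\<close>). Being an
  $\varepsilon$-solution then gives $L\eta^2\sigma^2 \le C\varepsilon p$.

  If $p = \eta L/2$, then $\eta\sigma^2 \le C\varepsilon$, and the lower bound on $\eta N$ gives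
  $N \ge c\,\sigma^2B^2/\varepsilon^2$. If $p = 1/K$, it gives
  $K R^2 \ge c\,L\sigma^2B^4/\varepsilon^3$, and the square root term follows from
  $\tau R \cdot hKR \le (\tau R + hKR)^2$ (\<open>time_from_step_size_bounds\<close>).
\<close>

section \<open>Expectations over independent three-valued samples\<close>

definition coin :: "real \<Rightarrow> real measure" where
  "coin p = measure_pmf (map_pmf (\<lambda>(u, v). if u then (if v then 1 else -1) else 0)
     (pair_pmf (bernoulli_pmf p) (bernoulli_pmf (1 / 2))))"

abbreviation coins :: "real \<Rightarrow> (nat \<times> nat \<times> nat \<Rightarrow> real) measure" where
  "coins p \<equiv> sample_space (coin p)"

lemma prob_space_coin: "prob_space (coin p)"
  unfolding coin_def by (rule measure_pmf.prob_space_axioms)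

lemma space_coin [simp]: "space (coin p) = UNIV" and sets_coin [simp]: "sets (coin p) = UNIV"
  by (simp_all add: coin_def)

lemma integral_coin:
  fixes \<phi> :: "real \<Rightarrow> 'b::{banach, second_countable_topology}"
  assumes "0 \<le> p" "p \<le> 1"
  shows "integral\<^sup>L (coin p) \<phi> = (1 - p) *\<^sub>R \<phi> 0 + (p / 2) *\<^sub>R (\<phi> 1 + \<phi> (-1))"
proof -
  have U: "(UNIV :: (bool \<times> bool) set) = {(True, True), (True, False), (False, True), (False, False)}"
    by auto
  show ?thesis
    unfolding coin_def integral_map_pmf
    by (subst integral_measure_pmf[of UNIV])
       (use assms in \<open>auto simp: U pmf_pair scaleR_add_right simp flip: scaleR_add_left\<close>)
qed

lemma integrable_coin:
  fixes \<phi> :: "real \<Rightarrow> 'b::{banach, second_countable_topology}"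
  shows "integrable (coin p) \<phi>"
  unfolding coin_def by (auto intro!: integrable_measure_pmf_finite)

lemma prob_space_coins: "prob_space (coins p)"
  unfolding sample_space_def by (intro prob_space_PiM prob_space_coin)

lemma space_coins [simp]: "space (coins p) = UNIV"
  by (simp add: sample_space_def space_PiM)

lemma measure_coins_UNIV [simp]: "measure (coins p) UNIV = 1"
  using prob_space.prob_space[OF prob_space_coins[of p]] by simp

text \<open>
  The noise is bounded, so every finite stage of the algorithm is a bounded function of the samples;
  this one closure property settles all integrability questions.
\<close>

definition bounded_rv :: "real \<Rightarrow> ((nat \<times> nat \<times> nat \<Rightarrow> real) \<Rightarrow> real) \<Rightarrow> bool" where
  "bounded_rv p Y \<longleftrightarrow> Y \<in> borel_measurable (coins p) \<and> (\<exists>C. \<forall>\<omega>. \<bar>Y \<omega>\<bar> \<le> C)"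

lemma bounded_rv_integrable: "bounded_rv p Y \<Longrightarrow> integrable (coins p) Y"
proof -
  interpret prob_space "coins p" by (rule prob_space_coins)
  assume "bounded_rv p Y"
  then obtain C where "Y \<in> borel_measurable (coins p)" "\<And>\<omega>. \<bar>Y \<omega>\<bar> \<le> C" by (auto simp: bounded_rv_def)
  then show "integrable (coins p) Y" by (intro integrable_const_bound[where B = C]) auto
qed

lemma bounded_rv_const: "bounded_rv p (\<lambda>\<omega>. k)"
  unfolding bounded_rv_def by auto

lemma bounded_rv_add:
  assumes "bounded_rv p X" "bounded_rv p Y" shows "bounded_rv p (\<lambda>\<omega>. X \<omega> + Y \<omega>)"
proof -
  obtain C D where "\<forall>\<omega>. \<bar>X \<omega>\<bar> \<le> C" "\<forall>\<omega>. \<bar>Y \<omega>\<bar> \<le> D" using assms by (auto simp: bounded_rv_def)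
  then have "\<bar>X \<omega> + Y \<omega>\<bar> \<le> C + D" for \<omega>
    by (intro order_trans[OF abs_triangle_ineq] add_mono) auto
  then show ?thesis using assms unfolding bounded_rv_def by auto
qed

lemma bounded_rv_mult:
  assumes "bounded_rv p X" "bounded_rv p Y" shows "bounded_rv p (\<lambda>\<omega>. X \<omega> * Y \<omega>)"
proof -
  obtain C D where "\<forall>\<omega>. \<bar>X \<omega>\<bar> \<le> C" "\<forall>\<omega>. \<bar>Y \<omega>\<bar> \<le> D" using assms by (auto simp: bounded_rv_def)
  then have "\<bar>X \<omega> * Y \<omega>\<bar> \<le> C * D" for \<omega>
    unfolding abs_mult by (intro mult_mono) (auto intro: order_trans[OF abs_ge_zero])
  then show ?thesis using assms unfolding bounded_rv_def by auto
qed

lemma bounded_rv_diff: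
  assumes "bounded_rv p X" "bounded_rv p Y" shows "bounded_rv p (\<lambda>\<omega>. X \<omega> - Y \<omega>)"
  using bounded_rv_add[OF assms(1) bounded_rv_mult[OF bounded_rv_const[of p "-1"] assms(2)]] by simp

lemma bounded_rv_sum:
  assumes "\<And>i. i \<in> A \<Longrightarrow> bounded_rv p (X i)" shows "bounded_rv p (\<lambda>\<omega>. \<Sum>i\<in>A. X i \<omega>)"
  using assms
  by (induction A rule: infinite_finite_induct) (auto intro: bounded_rv_const bounded_rv_add)

lemma bounded_rv_min0:
  assumes "bounded_rv p X" shows "bounded_rv p (\<lambda>\<omega>. min (X \<omega>) 0)"
proof -
  obtain C where "\<forall>\<omega>. \<bar>X \<omega>\<bar> \<le> C" using assms by (auto simp: bounded_rv_def)
  then have "\<bar>min (X \<omega>) 0\<bar> \<le> C" for \<omega> by (smt (verit))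
  then show ?thesis using assms unfolding bounded_rv_def by auto
qed

lemma bounded_rv_coordinate:
  assumes "\<And>\<xi>. \<bar>\<phi> \<xi>\<bar> \<le> C" shows "bounded_rv p (\<lambda>\<omega>. \<phi> (\<omega> a))"
proof -
  have "(\<lambda>\<omega>. \<omega> a) \<in> measurable (coins p) (coin p)"
    unfolding sample_space_def by (rule measurable_component_singleton) simp
  moreover have "\<phi> \<in> borel_measurable (coin p)" by (simp add: coin_def)
  ultimately have "(\<lambda>\<omega>. \<phi> (\<omega> a)) \<in> borel_measurable (coins p)" by (rule measurable_compose)
  then show ?thesis using assms unfolding bounded_rv_def by auto
qed

lemma bounded_rv_sgn: "bounded_rv p (\<lambda>\<omega>. sgn (\<omega> a))"
  by (rule bounded_rv_coordinate[of _ 1]) (auto simp: sgn_if)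

lemmas bounded_rv_intros =
  bounded_rv_const bounded_rv_add bounded_rv_diff bounded_rv_mult bounded_rv_sum bounded_rv_min0
  bounded_rv_sgn

text \<open>
  The samples other than the one at \<open>a\<close> form a product space of their own, and the whole space is
  its product with the sample at \<open>a\<close>; Fubini's theorem then separates the two factors.
\<close>

lemma expectation_independent_coordinate:
  assumes p: "0 \<le> p" "p \<le> 1"
    and Y: "bounded_rv p Y" and \<phi>: "\<And>\<xi>. \<bar>\<phi> \<xi>\<bar> \<le> C"
    and indep: "\<And>\<omega> v. Y (fun_upd \<omega> a v) = Y \<omega>"
  shows "(\<integral>\<omega>. Y \<omega> * \<phi> (\<omega> a) \<partial>coins p) = (\<integral>\<omega>. Y \<omega> \<partial>coins p) * (\<integral>\<xi>. \<phi> \<xi> \<partial>coin p)"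
proof -
  define N where "N = Pi\<^sub>M (UNIV - {a}) (\<lambda>_. coin p)"
  have N: "prob_space N" unfolding N_def by (intro prob_space_PiM prob_space_coin)
  interpret A: prob_space "coin p" by (rule prob_space_coin)
  interpret B: prob_space N by (rule N)
  interpret P: pair_prob_space "coin p" N ..
  have UN: "insert a (UNIV - {a}) = UNIV" by auto
  have meas: "(\<lambda>(x, X). fun_upd X a x) \<in> measurable (coin p \<Otimes>\<^sub>M N) (coins p)"
  proof -
    have "(\<lambda>(x, X). fun_upd X a x) \<in> measurable (coin p \<Otimes>\<^sub>M N) (Pi\<^sub>M (insert a (UNIV - {a})) (\<lambda>_. coin p))"
      unfolding N_def by measurable
    then show ?thesis by (simp add: UN sample_space_def)
  qed
  have D: "distr (coin p \<Otimes>\<^sub>M N) (coins p) (\<lambda>(x, X). fun_upd X a x) = coins p"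
    using distr_pair_PiM_eq_PiM[of "UNIV - {a}" "\<lambda>_. coin p" a] prob_space_coin
    by (simp add: UN sample_space_def N_def)
  have split: "(\<integral>\<omega>. Z \<omega> \<partial>coins p) = (\<integral>x. (\<integral>X. Z (fun_upd X a x) \<partial>N) \<partial>coin p)" if Z: "bounded_rv p Z" for Z
  proof -
    have Zm: "Z \<in> borel_measurable (coins p)" using Z by (simp add: bounded_rv_def)
    have int: "integrable (coin p \<Otimes>\<^sub>M N) (\<lambda>y. Z ((\<lambda>(x, X). fun_upd X a x) y))"
      by (rule integrable_distr[OF meas]) (simp add: D bounded_rv_integrable[OF Z])
    have "(\<integral>\<omega>. Z \<omega> \<partial>coins p) = (\<integral>y. Z ((\<lambda>(x, X). fun_upd X a x) y) \<partial>(coin p \<Otimes>\<^sub>M N))"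
      using integral_distr[OF meas Zm] by (simp add: D)
    also have "\<dots> = (\<integral>x. (\<integral>X. Z ((\<lambda>(x, X). fun_upd X a x) (x, X)) \<partial>N) \<partial>coin p)"
      using P.integral_fst'[OF int] by simp
    finally show ?thesis by simp
  qed
  have "(\<integral>\<omega>. Y \<omega> \<partial>coins p) = (\<integral>X. Y X \<partial>N)"
    using split[OF Y] A.prob_space by (simp add: indep)
  moreover have "(\<integral>\<omega>. Y \<omega> * \<phi> (\<omega> a) \<partial>coins p) = (\<integral>x. (\<integral>X. Y X \<partial>N) * \<phi> x \<partial>coin p)"
    using split[OF bounded_rv_mult[OF Y bounded_rv_coordinate[of \<phi>, OF \<phi>]]] by (simp add: indep)
  ultimately show ?thesis by simp
qed

lemma expectation_times_sgn:
  assumes "0 \<le> p" "p \<le> 1" "bounded_rv p Y" "\<And>\<omega> v. Y (fun_upd \<omega> a v) = Y \<omega>"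
  shows "(\<integral>\<omega>. Y \<omega> * sgn (\<omega> a) \<partial>coins p) = 0"
  by (subst expectation_independent_coordinate[of p Y sgn 1 a])
     (use assms in \<open>auto simp: sgn_if integral_coin\<close>)

text \<open>
  The cross terms vanish because every new sign has mean zero and is independent of what came before.
\<close>

lemma expectation_add_fresh_noise_square:
  fixes a :: "nat \<Rightarrow> nat \<times> nat \<times> nat"
  assumes p: "0 \<le> p" "p \<le> 1" and Y: "bounded_rv p Y"
    and indep: "\<And>i \<omega> v. i < n \<Longrightarrow> Y (fun_upd \<omega> (a i) v) = Y \<omega>" and inj: "inj a"
  shows "(\<integral>\<omega>. (Y \<omega> - w * (\<Sum>i<n. sgn (\<omega> (a i))))\<^sup>2 \<partial>coins p)
    = (\<integral>\<omega>. (Y \<omega>)\<^sup>2 \<partial>coins p) + real n * (w\<^sup>2 * p)"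
  using indep
proof (induction n)
  case 0
  then show ?case by simp
next
  case (Suc n)
  interpret prob_space "coins p" by (rule prob_space_coins)
  let ?Z = "\<lambda>\<omega>. Y \<omega> - w * (\<Sum>i<n. sgn (\<omega> (a i)))"
  have Z: "bounded_rv p ?Z" by (intro bounded_rv_intros Y)
  have indepZ: "?Z (fun_upd \<omega> (a n) v) = ?Z \<omega>" for \<omega> v
  proof -
    have "(\<Sum>i<n. sgn ((fun_upd \<omega> (a n) v) (a i))) = (\<Sum>i<n. sgn (\<omega> (a i)))"
      using inj by (intro sum.cong refl) (auto simp: inj_eq)
    then show ?thesis by (simp only: Suc.prems[OF lessI])
  qed
  have eq: "(Y \<omega> - w * (\<Sum>i<Suc n. sgn (\<omega> (a i))))\<^sup>2
      = (?Z \<omega>)\<^sup>2 + (w\<^sup>2 * (sgn (\<omega> (a n)) * sgn (\<omega> (a n))) - 2 * w * (?Z \<omega> * sgn (\<omega> (a n))))" for \<omega>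
    by (simp add: power2_eq_square algebra_simps)
  have one: "(\<integral>\<omega>. sgn (\<omega> (a n)) * sgn (\<omega> (a n)) \<partial>coins p) = p"
    using expectation_independent_coordinate[of p "\<lambda>_. 1" "\<lambda>\<xi>. sgn \<xi> * sgn \<xi>" 1 "a n"] p
    by (simp add: sgn_if bounded_rv_const integral_coin)
  have two: "(\<integral>\<omega>. ?Z \<omega> * sgn (\<omega> (a n)) \<partial>coins p) = 0"
    by (rule expectation_times_sgn[OF p Z indepZ])
  have int: "integrable (coins p) (\<lambda>\<omega>. (?Z \<omega>)\<^sup>2)"
    "integrable (coins p) (\<lambda>\<omega>. sgn (\<omega> (a n)) * sgn (\<omega> (a n)))"
    "integrable (coins p) (\<lambda>\<omega>. ?Z \<omega> * sgn (\<omega> (a n)))"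
    unfolding power2_eq_square
    by (intro bounded_rv_integrable bounded_rv_mult bounded_rv_const bounded_rv_sgn Z)+
  have "(\<integral>\<omega>. (Y \<omega> - w * (\<Sum>i<Suc n. sgn (\<omega> (a i))))\<^sup>2 \<partial>coins p)
      = (\<integral>\<omega>. (?Z \<omega>)\<^sup>2 \<partial>coins p) + (w\<^sup>2 * (\<integral>\<omega>. sgn (\<omega> (a n)) * sgn (\<omega> (a n)) \<partial>coins p)
         - 2 * w * (\<integral>\<omega>. ?Z \<omega> * sgn (\<omega> (a n)) \<partial>coins p))"
    unfolding eq
    by (subst Bochner_Integration.integral_add Bochner_Integration.integral_diff
          integral_mult_right_zero;
        (intro int Bochner_Integration.integrable_diff integrable_mult_right)?)+ (rule refl)
  also have "\<dots> = (\<integral>\<omega>. (Y \<omega>)\<^sup>2 \<partial>coins p) + real (Suc n) * (w\<^sup>2 * p)"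
    unfolding one two using Suc by (simp add: algebra_simps)
  finally show ?case .
qed

section \<open>Convex problems with different curvatures on the two sides of the minimizer\<close>

text \<open>The derivative of \<open>loss a b\<close> below: \<open>a * s\<close> for \<open>s \<le> 0\<close> and \<open>b * s\<close> for \<open>s \<ge> 0\<close>.\<close>

definition slope :: "real \<Rightarrow> real \<Rightarrow> real \<Rightarrow> real" where
  "slope a b s = b * s + (a - b) * min s 0"

definition loss :: "real \<Rightarrow> real \<Rightarrow> real \<Rightarrow> real" where
  "loss a b s = b / 2 * s\<^sup>2 + (a - b) / 2 * (min s 0)\<^sup>2"

definition noisy_slope :: "real \<Rightarrow> real \<Rightarrow> real \<Rightarrow> real \<Rightarrow> real \<Rightarrow> real" where
  "noisy_slope a b c s \<xi> = slope a b s + c * sgn \<xi>"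

text \<open>At the kink the factorization \<open>(min s 0)\<^sup>2 = min s 0 * s\<close> exhibits the derivative.\<close>

lemma DERIV_min0_square: "((\<lambda>s::real. (min s 0)\<^sup>2) has_real_derivative 2 * min s 0) (at s)"
proof -
  consider "s < 0" | "s = 0" | "s > 0" by linarith
  then show ?thesis
  proof cases
    case 1
    have "((\<lambda>s::real. s\<^sup>2) has_real_derivative 2 * min s 0) (at s)"
      using 1 by (auto intro!: derivative_eq_intros)
    then show ?thesis
      by (rule has_field_derivative_transform_within_open[of _ _ _ "{..<0}"]) (use 1 in auto)
  next
    case 2
    have "isCont (\<lambda>s::real. min s 0) 0" by (intro continuous_intros)
    with 2 show ?thesis
      unfolding CARAT_DERIV
      by (intro exI[of _ "\<lambda>s. min s 0"] conjI allI) (simp_all add: min_def power2_eq_square)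
  next
    case 3
    have "((\<lambda>s::real. 0) has_real_derivative 2 * min s 0) (at s)" using 3 by auto
    then show ?thesis
      by (rule has_field_derivative_transform_within_open[of _ _ _ "{0<..}"]) (use 3 in auto)
  qed
qed

lemma DERIV_loss: "(loss a b has_real_derivative slope a b s) (at s)"
  unfolding loss_def slope_def
  by (rule derivative_eq_intros DERIV_min0_square refl)+ simp

lemma slope_mono: assumes "0 \<le> b" "b \<le> a" "s \<le> t" shows "slope a b s \<le> slope a b t"
  unfolding slope_def using assms by (intro add_mono mult_left_mono min.mono) auto

lemma slope_lipschitz:
  assumes "0 \<le> b" "b \<le> a" shows "\<bar>slope a b s - slope a b t\<bar> \<le> a * \<bar>s - t\<bar>"
proof -
  have "slope a b s - slope a b t = b * (s - t) + (a - b) * (min s 0 - min t 0)"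
    by (simp add: slope_def algebra_simps)
  also have "\<bar>\<dots>\<bar> \<le> b * \<bar>s - t\<bar> + (a - b) * \<bar>min s 0 - min t 0\<bar>"
    using assms by (intro order_trans[OF abs_triangle_ineq]) (auto simp: abs_mult)
  also have "\<dots> \<le> b * \<bar>s - t\<bar> + (a - b) * \<bar>s - t\<bar>"
    using assms by (intro add_left_mono mult_left_mono) auto
  finally show ?thesis by (simp add: algebra_simps)
qed

lemma convex_loss: assumes "0 \<le> b" "b \<le> a" shows "convex_on UNIV (loss a b)"
  by (rule convex_on_realI[where f' = "slope a b"]) (use assms DERIV_loss slope_mono in auto)

text \<open>
  Through this bound a small expected loss limits the second moment of the iterate, and with it
  the square of its mean.
\<close>

lemma loss_ge_square: "b \<le> a \<Longrightarrow> b / 2 * s\<^sup>2 \<le> loss a b s"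
  by (simp add: loss_def)

text \<open>
  The loss depends on one coordinate only, so the instances exist in every dimension. Their
  minimizers form a hyperplane, on which the origin is the point closest to \<open>B *\<^sub>R e\<close>. A noise level \<open>c\<close>
  with probability \<open>p\<close> has variance \<open>c\<^sup>2 * p\<close>, so rare noise may be large.
\<close>

lemma hard_problem:
  fixes e :: "'a::euclidean_space"
  assumes e: "e \<in> Basis" and ab: "0 < b" "b \<le> a" "a \<le> L" and B: "0 < B"
    and p: "0 < p" "p \<le> 1" and c: "c\<^sup>2 * p = \<sigma>\<^sup>2"
  shows "stochastic_convex_problem (coin p) L B \<sigma>
    (\<lambda>x. loss a b (x \<bullet> e)) (\<lambda>x. slope a b (x \<bullet> e) *\<^sub>R e)
    (\<lambda>x \<xi>. loss a b (x \<bullet> e) + c * sgn \<xi> * (x \<bullet> e)) (\<lambda>x \<xi>. noisy_slope a b c (x \<bullet> e) \<xi> *\<^sub>R e)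
    (B *\<^sub>R e) 0"
proof -
  interpret prob_space "coin p" by (rule prob_space_coin)
  have ee: "e \<bullet> e = 1" "norm e = 1" using e by auto
  have inner: "GDERIV (\<lambda>y. y \<bullet> e) x :> e" for x
    unfolding gderiv_def by (intro derivative_eq_intros) auto
  have loss: "GDERIV (\<lambda>y. loss a b (y \<bullet> e)) x :> slope a b (x \<bullet> e) *\<^sub>R e" for x
    by (rule GDERIV_DERIV_compose[OF inner DERIV_loss])
  have loss_nonneg: "0 \<le> loss a b s" for s
    using ab by (auto simp: loss_def intro!: add_nonneg_nonneg mult_nonneg_nonneg)
  have loss0: "loss a b 0 = 0" by (simp add: loss_def)
  note coin = integral_coin[OF less_imp_le[OF p(1)] p(2)]
  show ?thesis
  proof
    fix x :: 'a
    show "GDERIV (\<lambda>x. loss a b (x \<bullet> e)) x :> slope a b (x \<bullet> e) *\<^sub>R e" by (rule loss)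
  next
    fix x y :: 'a
    have "norm (slope a b (x \<bullet> e) *\<^sub>R e - slope a b (y \<bullet> e) *\<^sub>R e)
        = \<bar>slope a b (x \<bullet> e) - slope a b (y \<bullet> e)\<bar>"
      by (simp add: ee flip: scaleR_diff_left)
    also have "\<dots> \<le> a * \<bar>(x - y) \<bullet> e\<bar>"
      using slope_lipschitz[of b a] ab by (simp add: inner_diff_left)
    also have "\<dots> \<le> L * norm (x - y)"
      using ab Basis_le_norm[OF e, of "x - y"] by (intro mult_mono) auto
    finally show "norm (slope a b (x \<bullet> e) *\<^sub>R e - slope a b (y \<bullet> e) *\<^sub>R e) \<le> L * norm (x - y)" .
  next
    show "convex_on UNIV (\<lambda>x. loss a b (x \<bullet> e))"
    proof (rule convex_onI)
      fix t :: real and x y :: 'a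
      assume "0 < t" "t < 1"
      then show "loss a b (((1 - t) *\<^sub>R x + t *\<^sub>R y) \<bullet> e)
          \<le> (1 - t) * loss a b (x \<bullet> e) + t * loss a b (y \<bullet> e)"
        using convex_onD[OF convex_loss[of b a], of t "x \<bullet> e" "y \<bullet> e"] ab
        by (simp add: inner_add_left)
    qed simp
  next
    fix y :: 'a
    show "loss a b (0 \<bullet> e) \<le> loss a b (y \<bullet> e)" using loss_nonneg loss0 by simp
  next
    fix y :: 'a
    assume "\<And>z :: 'a. loss a b (y \<bullet> e) \<le> loss a b (z \<bullet> e)"
    from this[of 0] have "b / 2 * (y \<bullet> e)\<^sup>2 \<le> 0"
      using loss_ge_square[of b a "y \<bullet> e"] ab loss0 by simp
    then have "y \<bullet> e = 0" using ab by (simp add: mult_le_0_iff)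
    then have "\<bar>(B *\<^sub>R e - y) \<bullet> e\<bar> = norm (B *\<^sub>R e - 0)" by (simp add: inner_diff_left ee)
    then show "norm (B *\<^sub>R e - 0) \<le> norm (B *\<^sub>R e - y)"
      using Basis_le_norm[OF e, of "B *\<^sub>R e - y"] by simp
  next
    show "B = norm (B *\<^sub>R e - 0)" using B ee by simp
  next
    fix x :: 'a
    show "loss a b (x \<bullet> e) = (\<integral>\<xi>. loss a b (x \<bullet> e) + c * sgn \<xi> * (x \<bullet> e) \<partial>coin p)"
      by (simp add: coin field_simps)
  next
    fix x :: 'a and \<xi> :: real
    have "GDERIV (\<lambda>y. loss a b (y \<bullet> e) + c * sgn \<xi> * (y \<bullet> e)) x
        :> slope a b (x \<bullet> e) *\<^sub>R e + (c * sgn \<xi>) *\<^sub>R e"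
      using loss[of x] unfolding gderiv_def
      by (intro derivative_eq_intros) (auto simp: fun_eq_iff inner_add_right)
    then show "GDERIV (\<lambda>y. loss a b (y \<bullet> e) + c * sgn \<xi> * (y \<bullet> e)) x
        :> noisy_slope a b c (x \<bullet> e) \<xi> *\<^sub>R e"
      by (simp add: noisy_slope_def scaleR_add_left)
  next
    have "(\<lambda>z. sgn (snd z)) \<in> borel_measurable ((borel :: 'a measure) \<Otimes>\<^sub>M coin p)"
      by (rule measurable_compose[OF measurable_snd]) (simp add: coin_def)
    then show "(\<lambda>(x::'a, \<xi>). noisy_slope a b c (x \<bullet> e) \<xi> *\<^sub>R e) \<in> borel_measurable (borel \<Otimes>\<^sub>M coin p)"
      unfolding noisy_slope_def slope_def split_beta by measurable
  next
    fix x :: 'a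
    show "(\<integral>\<xi>. noisy_slope a b c (x \<bullet> e) \<xi> *\<^sub>R e \<partial>coin p) = slope a b (x \<bullet> e) *\<^sub>R e"
      by (subst integral_scaleR_left) (auto simp: integrable_coin coin noisy_slope_def field_simps)
  next
    fix x :: 'a
    have "(norm (noisy_slope a b c (x \<bullet> e) \<xi> *\<^sub>R e - slope a b (x \<bullet> e) *\<^sub>R e))\<^sup>2 = c\<^sup>2 * (sgn \<xi>)\<^sup>2" for \<xi>
      by (simp add: noisy_slope_def ee power_mult_distrib abs_mult sgn_if flip: scaleR_diff_left)
    then show "(\<integral>\<xi>. (norm (noisy_slope a b c (x \<bullet> e) \<xi> *\<^sub>R e - slope a b (x \<bullet> e) *\<^sub>R e))\<^sup>2 \<partial>coin p) \<le> \<sigma>\<^sup>2"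
      using c by (simp add: coin algebra_simps)
  qed (simp_all add: integrable_coin)
qed


section \<open>Local SGD on the one-dimensional problems\<close>

lemma local_steps_inner:
  fixes e :: "'a::euclidean_space"
  assumes "e \<in> Basis"
  shows "local_steps (\<lambda>x \<xi>. g (x \<bullet> e) \<xi> *\<^sub>R e) \<eta> s x j \<bullet> e = local_steps g \<eta> s (x \<bullet> e) j"
  using assms by (induction j) (auto simp: inner_diff_left)

lemma local_sgd_inner:
  fixes e :: "'a::euclidean_space"
  assumes "e \<in> Basis"
  shows "local_sgd (\<lambda>x \<xi>. g (x \<bullet> e) \<xi> *\<^sub>R e) n \<eta> K x \<omega> t \<bullet> e = local_sgd g n \<eta> K (x \<bullet> e) \<omega> t"
  using assms by (induction t) (auto simp: inner_sum_left local_steps_inner)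

text \<open>
  The next two lemmas say that a stage of the algorithm depends on past samples only; they make the
  current sample independent of it.
\<close>

lemma local_steps_cong:
  "(\<And>k. k < j \<Longrightarrow> s k = s' k) \<Longrightarrow> local_steps g \<eta> s x j = local_steps g \<eta> s' x j"
  by (induction j) auto

lemma local_sgd_cong:
  "(\<And>t' i j. t' < t \<Longrightarrow> \<omega> (t', i, j) = \<omega>' (t', i, j)) \<Longrightarrow>
    local_sgd g n \<eta> K x \<omega> t = local_sgd g n \<eta> K x \<omega>' t"
  by (induction t) (auto intro!: sum.cong arg_cong2[where f = scaleR] local_steps_cong)

lemma bounded_rv_local_steps:
  assumes "bounded_rv p X"
  shows "bounded_rv p (\<lambda>\<omega>. local_steps (noisy_slope a b c) \<eta> (\<lambda>j. \<omega> (t, i, j)) (X \<omega>) m)"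
  by (induction m) (auto simp: noisy_slope_def slope_def intro!: bounded_rv_intros assms)

lemma bounded_rv_local_sgd:
  "bounded_rv p (\<lambda>\<omega>. local_sgd (noisy_slope a b c) n \<eta> K x \<omega> t)"
proof (induction t)
  case (Suc t)
  then show ?case
    unfolding local_sgd.simps real_scaleR_def
    by (intro bounded_rv_mult bounded_rv_const bounded_rv_sum bounded_rv_local_steps)
qed (simp add: bounded_rv_const)

lemma local_steps_fresh:
  assumes "m \<le> j"
  shows "local_steps g \<eta> (\<lambda>k. (fun_upd \<omega> (t, i', j) v) (t, i, k))
      (local_sgd g n \<eta> K x (fun_upd \<omega> (t, i', j) v) t) m
    = local_steps g \<eta> (\<lambda>k. \<omega> (t, i, k)) (local_sgd g n \<eta> K x \<omega> t) m"
proof -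
  have "local_sgd g n \<eta> K x (fun_upd \<omega> (t, i', j) v) t = local_sgd g n \<eta> K x \<omega> t"
    by (rule local_sgd_cong) auto
  then show ?thesis using assms by (auto intro: local_steps_cong)
qed


section \<open>Quadratic functions\<close>

text \<open>
  For a linear gradient the average of the workers obeys the same recursion as a single worker,
  with the noise averaged over \<open>n\<close> independent samples. Communication then has no effect on the
  average, and only the total number of steps matters.
\<close>

lemma second_moment_quadratic:
  assumes p: "0 \<le> p" "p \<le> 1" and n: "n \<ge> 1"
  shows "(\<integral>\<omega>. (local_sgd (noisy_slope \<mu> \<mu> c) n \<eta> K x \<omega> t)\<^sup>2 \<partial>coins p)
    = ((\<lambda>v. (1 - \<eta> * \<mu>)\<^sup>2 * v + \<eta>\<^sup>2 * (c\<^sup>2 * p) / real n) ^^ (K * t)) (x\<^sup>2)"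
proof (induction t)
  case 0
  interpret prob_space "coins p" by (rule prob_space_coins)
  show ?case by (simp add: prob_space)
next
  case (Suc t)
  define step where "step v = (1 - \<eta> * \<mu>)\<^sup>2 * v + \<eta>\<^sup>2 * (c\<^sup>2 * p) / real n" for v
  define X where "X \<omega> = local_sgd (noisy_slope \<mu> \<mu> c) n \<eta> K x \<omega> t" for \<omega>
  define Z where "Z i j \<omega> = local_steps (noisy_slope \<mu> \<mu> c) \<eta> (\<lambda>k. \<omega> (t, i, k)) (X \<omega>) j" for i j \<omega>
  define Y where "Y j \<omega> = (1 / real n) * (\<Sum>i<n. Z i j \<omega>)" for j \<omega>
  have Z: "bounded_rv p (Z i j)" for i j
    unfolding Z_def X_def by (intro bounded_rv_local_steps bounded_rv_local_sgd)
  have "(\<integral>\<omega>. (Y j \<omega>)\<^sup>2 \<partial>coins p) = (step ^^ j) (\<integral>\<omega>. (X \<omega>)\<^sup>2 \<partial>coins p)" for j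
  proof (induction j)
    case 0
    have "Y 0 \<omega> = X \<omega>" for \<omega> using n by (simp add: Y_def Z_def)
    then show ?case by simp
  next
    case (Suc j)
    have "Z i (Suc j) \<omega> = (1 - \<eta> * \<mu>) * Z i j \<omega> - \<eta> * c * sgn (\<omega> (t, i, j))" for i \<omega>
      by (simp add: Z_def noisy_slope_def slope_def algebra_simps)
    then have "(\<Sum>i<n. Z i (Suc j) \<omega>)
        = (1 - \<eta> * \<mu>) * (\<Sum>i<n. Z i j \<omega>) - \<eta> * c * (\<Sum>i<n. sgn (\<omega> (t, i, j)))" for \<omega>
      by (simp only: sum_subtractf sum_distrib_left)
    then have eq: "Y (Suc j) \<omega>
        = (1 - \<eta> * \<mu>) * Y j \<omega> - (\<eta> * c / real n) * (\<Sum>i<n. sgn (\<omega> (t, i, j)))" for \<omega>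
      by (simp add: Y_def diff_divide_distrib)
    have "(\<integral>\<omega>. (Y (Suc j) \<omega>)\<^sup>2 \<partial>coins p)
        = (\<integral>\<omega>. ((1 - \<eta> * \<mu>) * Y j \<omega>)\<^sup>2 \<partial>coins p) + real n * ((\<eta> * c / real n)\<^sup>2 * p)"
      unfolding eq
    proof (rule expectation_add_fresh_noise_square[OF p])
      show "bounded_rv p (\<lambda>\<omega>. (1 - \<eta> * \<mu>) * Y j \<omega>)"
        unfolding Y_def by (intro bounded_rv_intros Z)
      show "(1 - \<eta> * \<mu>) * Y j (fun_upd \<omega> (t, i, j) v) = (1 - \<eta> * \<mu>) * Y j \<omega>" for i \<omega> v
        unfolding Y_def Z_def X_def by (subst local_steps_fresh) auto
    qed (auto simp: inj_def)
    also have "\<dots> = (1 - \<eta> * \<mu>)\<^sup>2 * (\<integral>\<omega>. (Y j \<omega>)\<^sup>2 \<partial>coins p) + \<eta>\<^sup>2 * (c\<^sup>2 * p) / real n"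
    proof -
      have "real n * ((\<eta> * c / real n)\<^sup>2 * p) = \<eta>\<^sup>2 * (c\<^sup>2 * p) / real n"
        using n by (simp add: power2_eq_square field_simps)
      then show ?thesis unfolding power_mult_distrib[of _ "Y j _"] by simp
    qed
    finally show ?case using Suc by (simp add: step_def)
  qed
  note this[of K]
  moreover have "Y K \<omega> = local_sgd (noisy_slope \<mu> \<mu> c) n \<eta> K x \<omega> (Suc t)" for \<omega>
    by (simp add: Y_def Z_def X_def)
  ultimately show ?case
    using Suc.IH by (simp add: X_def step_def[abs_def] funpow_add)
qed

lemma affine_iterate:
  fixes Q W v :: real
  assumes "0 \<le> Q" "0 \<le> W"
  shows "Q ^ N * v \<le> ((\<lambda>v. Q * v + W) ^^ N) v"
    and "(1 - Q) * ((\<lambda>v. Q * v + W) ^^ N) v = W * (1 - Q ^ N) + Q ^ N * ((1 - Q) * v)"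
proof -
  show "Q ^ N * v \<le> ((\<lambda>v. Q * v + W) ^^ N) v"
  proof (induction N)
    case (Suc N)
    have "Q ^ Suc N * v = Q * (Q ^ N * v)" by simp
    also have "\<dots> \<le> Q * ((\<lambda>v. Q * v + W) ^^ N) v + W"
      using mult_left_mono[OF Suc assms(1)] assms(2) by simp
    finally show ?case by simp
  qed simp
  show "(1 - Q) * ((\<lambda>v. Q * v + W) ^^ N) v = W * (1 - Q ^ N) + Q ^ N * ((1 - Q) * v)"
  proof (induction N)
    case (Suc N)
    have "(1 - Q) * ((\<lambda>v. Q * v + W) ^^ Suc N) v
        = Q * ((1 - Q) * ((\<lambda>v. Q * v + W) ^^ N) v) + (1 - Q) * W"
      by (simp add: algebra_simps)
    also have "\<dots> = W * (1 - Q ^ Suc N) + Q ^ Suc N * ((1 - Q) * v)"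
      unfolding Suc by (simp add: algebra_simps)
    finally show ?case .
  qed simp
qed

text \<open>
  Here \<open>y\<close> is the step size times the curvature, and \<open>(1 - y)\<^sup>2\<close> the factor by which one step
  multiplies the squared distance.
\<close>

lemma contraction_needs_steps:
  fixes y :: real
  assumes "0 < y" "((1 - y)\<^sup>2) ^ N \<le> 1 / 2"
  shows "y < 2" "1 / 4 \<le> real N * y"
proof -
  show "y < 2"
  proof (rule ccontr)
    assume "\<not> y < 2"
    then have "1 \<le> \<bar>1 - y\<bar>" by simp
    then have "1\<^sup>2 \<le> \<bar>1 - y\<bar>\<^sup>2" by (intro power_mono) auto
    then have "1 \<le> (1 - y)\<^sup>2" by simp
    then show False using one_le_power[of "(1 - y)\<^sup>2" N] assms(2) by linarith
  qed
  have "1 + real N * ((1 - y)\<^sup>2 - 1) \<le> (1 + ((1 - y)\<^sup>2 - 1)) ^ N"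
    by (rule Bernoulli_inequality) simp
  then have "1 / 2 \<le> real N * (1 - (1 - y)\<^sup>2)" using assms by (simp add: algebra_simps)
  also have "\<dots> \<le> real N * (2 * y)"
    by (intro mult_left_mono) (auto simp: power2_eq_square algebra_simps)
  finally show "1 / 4 \<le> real N * y" by simp
qed

section \<open>The drift caused by unequal curvatures\<close>

text \<open>
  Let $e_j$ be the expected position of a worker after $j$ local steps and $u_j$ the expectation of
  its negative part. With curvatures $2b$ and $b$, $l = \eta b$ and jumps of length $J$, these satisfy
  \[ e_{j+1} = (1-l) e_j + l u_j, \qquad
     u_{j+1} \ge (1-p)(1-2l) u_j + \tfrac p2 (J - e_{j+1}). \]
  A larger $e$ makes the bound on $u$ smaller, so lower bounds on $e$ and $u$ do not propagate
  forwards. Instead the linear functional $\alpha e + \gamma u + \beta J$ is pulled back through them, starting from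
  $e$ itself; this is legitimate as long as the weights of $e_{j+1}$ and $u_{j+1}$ are
  nonnegative.
\<close>

primrec drift_weights :: "real \<Rightarrow> real \<Rightarrow> nat \<Rightarrow> real \<times> real \<times> real" where
  "drift_weights l p 0 = (1, 0, 0)"
| "drift_weights l p (Suc m) =
     (case drift_weights l p m of (\<alpha>, \<gamma>, \<beta>) \<Rightarrow>
        ((1 - l) * (\<alpha> - p / 2 * \<gamma>),
         l * (\<alpha> - p / 2 * \<gamma>) + (1 - p) * (1 - 2 * l) * \<gamma>,
         \<beta> + p / 2 * \<gamma>))"

text \<open>
  The cone \<open>0 \<le> \<gamma> \<le> \<alpha>\<close> is invariant; inside it the weight \<open>\<alpha> - p / 2 * \<gamma>\<close> that the pull back gives to
  the new expectation is nonnegative.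
\<close>

lemma drift_weights_bounds:
  assumes "0 \<le> l" "l \<le> 1 / 2" "0 \<le> p" "p \<le> 1" "drift_weights l p m = (\<alpha>, \<gamma>, \<beta>)"
  shows "0 \<le> \<gamma> \<and> \<gamma> \<le> \<alpha> \<and> \<alpha> \<le> (1 - l) ^ m"
  using assms(5)
proof (induction m arbitrary: \<alpha> \<gamma> \<beta>)
  case 0
  then show ?case by simp
next
  case (Suc m)
  obtain a c b where w: "drift_weights l p m = (a, c, b)" by (metis prod_cases3)
  then have IH: "0 \<le> c" "c \<le> a" "a \<le> (1 - l) ^ m" using Suc.IH by auto
  define r where "r = a - p / 2 * c"
  have eqs: "\<alpha> = (1 - l) * r" "\<gamma> = l * r + (1 - p) * (1 - 2 * l) * c"
    using Suc.prems w by (auto simp: r_def)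
  have pc: "p / 2 * c \<le> 1 * c" "0 \<le> p / 2 * c"
    using IH assms by (intro mult_right_mono mult_nonneg_nonneg; simp)+
  then have r0: "0 \<le> r" and ra: "r \<le> a" using IH by (auto simp: r_def)
  have "(1 - p) * c \<le> (1 - p / 2) * c"
    using assms IH by (intro mult_right_mono) auto
  also have "\<dots> \<le> r" using IH by (simp add: r_def algebra_simps)
  finally have "(1 - 2 * l) * ((1 - p) * c) \<le> (1 - 2 * l) * r"
    using assms by (intro mult_left_mono) auto
  then have "\<gamma> \<le> \<alpha>" by (simp add: eqs algebra_simps)
  moreover have "0 \<le> \<gamma>" unfolding eqs using assms IH r0 by auto
  moreover have "\<alpha> \<le> (1 - l) ^ Suc m"
    unfolding eqs power_Suc using assms IH ra by (intro mult_left_mono) auto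
  ultimately show ?case by simp
qed

lemma drift_weights_lower_bound:
  fixes e u :: "nat \<Rightarrow> real"
  assumes l: "0 \<le> l" "l \<le> 1 / 2" and p: "0 \<le> p" "p \<le> 1"
    and e: "\<And>j. (1 - l) * e j + l * u j \<le> e (Suc j)"
    and u: "\<And>j. (1 - p) * (1 - 2 * l) * u j + p / 2 * (J - e (Suc j)) \<le> u (Suc j)"
    and w: "drift_weights l p m = (\<alpha>, \<gamma>, \<beta>)"
  shows "\<alpha> * e j + \<gamma> * u j + \<beta> * J \<le> e (j + m)"
  using w
proof (induction m arbitrary: \<alpha> \<gamma> \<beta> j)
  case 0
  then show ?case by simp
next
  case (Suc m)
  obtain a c b where w: "drift_weights l p m = (a, c, b)" by (metis prod_cases3)
  have bounds: "0 \<le> c" "c \<le> a" using drift_weights_bounds[OF l p w] by auto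
  have pc: "p / 2 * c \<le> 1 * c" using p bounds by (intro mult_right_mono) auto
  have eqs: "\<alpha> = (1 - l) * (a - p / 2 * c)"
      "\<gamma> = l * (a - p / 2 * c) + (1 - p) * (1 - 2 * l) * c" "\<beta> = b + p / 2 * c"
    using Suc.prems w by auto
  have "\<alpha> * e j + \<gamma> * u j + \<beta> * J
      = (a - p / 2 * c) * ((1 - l) * e j + l * u j)
        + c * ((1 - p) * (1 - 2 * l) * u j) + (b + p / 2 * c) * J"
    unfolding eqs by (simp only: algebra_simps)
  also have "\<dots> \<le> (a - p / 2 * c) * e (Suc j)
        + c * ((1 - p) * (1 - 2 * l) * u j) + (b + p / 2 * c) * J"
    using e[of j] pc bounds by (intro add_right_mono mult_left_mono) auto
  also have "\<dots> = a * e (Suc j)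
        + c * ((1 - p) * (1 - 2 * l) * u j + p / 2 * (J - e (Suc j))) + b * J"
    by (simp add: field_simps)
  also have "\<dots> \<le> a * e (Suc j) + c * u (Suc j) + b * J"
    using u[of j] bounds by (intro add_mono mult_left_mono order_refl) auto
  also have "\<dots> \<le> e (Suc j + m)" using Suc.IH[OF w] .
  finally show ?case by simp
qed

text \<open>
  Iterating $e \mapsto \alpha e + \beta J$ leads to the fixed point $\beta J/(1-\alpha)$, so this ratio decides
  how far the drift carries the mean. The total weight lost by $\alpha$ is $1-\alpha = \beta + lS$ with $S$ the sum of the weights
  \<open>r j\<close> that pass through a step. What enters $\gamma$ in total is $lS$; it leaves at rate $1-q \le 2p$ per
  step, and a quarter at least of what leaves goes to $\beta$. It remains to see that a fixed fraction
  has left after \<open>K\<close> steps. Since \<open>r\<close> is decreasing, the inflow is spread over the steps, or came early, and since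
  $q \le 1 - 1/K$, much of it is gone at the end: $\gamma \le \frac78 lS$.
\<close>

lemma drift_weights_ratio:
  assumes l: "0 \<le> l" "l \<le> 1 / 2" and p: "2 * l \<le> p" "p \<le> 1" "1 / real K \<le> p" and K: "K \<ge> 2"
    and w: "drift_weights l p K = (\<alpha>, \<gamma>, \<beta>)"
  shows "0 \<le> \<beta>" "1 - \<alpha> \<le> 33 * \<beta>"
proof -
  define q where "q = (1 - p) * (1 - 2 * l)"
  have p0: "0 \<le> p" using l p by simp
  have p_pos: "0 < p" using p(3) K by (smt (verit) divide_pos_pos of_nat_0_less_iff pos2 order_less_le_trans)
  have "q \<le> (1 - p) * 1" unfolding q_def using l p by (intro mult_left_mono) auto
  then have q_le: "q \<le> 1 - 1 / real K" using p by simp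
  have q0: "0 \<le> q" unfolding q_def using l p by auto
  define r where "r j = (case drift_weights l p j of (a, c, b) \<Rightarrow> a - p / 2 * c)" for j
  define S where "S m = (\<Sum>j<m. r j)" for m
  have r_dec: "r (Suc j) \<le> r j" and r0: "0 \<le> r j" for j
  proof -
    obtain a c b where d: "drift_weights l p j = (a, c, b)" by (metis prod_cases3)
    obtain a' c' b' where d': "drift_weights l p (Suc j) = (a', c', b')" by (metis prod_cases3)
    have B: "0 \<le> c" "c \<le> a" "0 \<le> c'"
      using drift_weights_bounds[OF l p0 p(2) d] drift_weights_bounds[OF l p0 p(2) d'] by auto
    have "p / 2 * c \<le> 1 * c" using p B by (intro mult_right_mono) auto
    then show r0: "0 \<le> r j" using B d by (simp add: r_def)
    have "r (Suc j) \<le> a'" using d' B p0 by (simp add: r_def)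
    also have "a' = (1 - l) * r j" using d d' by (auto simp: r_def)
    also have "\<dots> \<le> 1 * r j" using l r0 by (intro mult_right_mono) auto
    finally show "r (Suc j) \<le> r j" by simp
  qed
  have S0: "0 \<le> S m" for m unfolding S_def using r0 by (intro sum_nonneg) auto
  have S_ge: "real m * r m \<le> S m" for m
  proof (induction m)
    case (Suc m)
    have "real (Suc m) * r (Suc m) \<le> real (Suc m) * r m"
      using r_dec by (intro mult_left_mono) auto
    also have "\<dots> \<le> S (Suc m)" using Suc by (simp add: S_def algebra_simps)
    finally show ?case .
  qed (simp add: S_def)
  (* The last conjunct is the decay estimate. Its factor is fixed by what the induction step needs:
     the factor drops by one per step, and multiplication by q makes it drop by at least two, since m <= K. The slack
     pays for the new inflow, which is at most 1/m of the old one. *)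
  have main: "m \<le> K \<Longrightarrow> drift_weights l p m = (a, c, b) \<Longrightarrow>
      0 \<le> b \<and> 1 - a = b + l * S m \<and> p / 2 * (l * S m - c) = (1 - q) * b \<and>
      4 * real K * c \<le> l * S m * (4 * real K + 1 - real m)" for m a b c
  proof (induction m arbitrary: a b c)
    case 0
    then show ?case by (simp add: S_def)
  next
    case (Suc m)
    obtain a' c' b' where d: "drift_weights l p m = (a', c', b')" by (metis prod_cases3)
    have IH: "0 \<le> b'" "1 - a' = b' + l * S m" "p / 2 * (l * S m - c') = (1 - q) * b'"
      "4 * real K * c' \<le> l * S m * (4 * real K + 1 - real m)"
      using Suc.IH[OF _ d] Suc.prems by auto
    have c'0: "0 \<le> c'" using drift_weights_bounds[OF l p0 p(2) d] by auto
    have rm: "r m = a' - p / 2 * c'" using d by (simp add: r_def)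
    have eqs: "a = (1 - l) * r m" "c = l * r m + q * c'" "b = b' + p / 2 * c'"
      using Suc.prems d by (auto simp: rm q_def)
    have SS: "S (Suc m) = S m + r m" by (simp add: S_def)
    have "1 - a = b + l * S (Suc m)"
      using IH(2) rm unfolding eqs SS by (simp only: algebra_simps)
    moreover have "p / 2 * (l * S (Suc m) - c) = (1 - q) * b"
      using IH(3) unfolding eqs SS by (simp add: field_simps)
    moreover have "0 \<le> b" unfolding eqs using IH(1) c'0 p0 by simp
    moreover have "4 * real K * c \<le> l * S (Suc m) * (4 * real K + 1 - real (Suc m))"
    proof -
      have mK: "real m \<le> real K" "real K > 0" using Suc.prems K by auto
      have "q * (4 * real K + 1 - real m) \<le> (1 - 1 / real K) * (4 * real K + 1 - real m)"
        using q_le mK by (intro mult_right_mono) auto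
      also have "\<dots> = (4 * real K + 1 - real m) - 4 - (1 - real m) / real K"
        using mK by (simp add: field_simps)
      also have "\<dots> \<le> (4 * real K + 1 - real m) - 2"
        using mK by (simp add: field_simps)
      finally have q_step: "q * (4 * real K + 1 - real m) \<le> 4 * real K - 1 - real m" by simp
      have "4 * real K * c = l * (4 * real K * r m) + q * (4 * real K * c')"
        unfolding eqs by (simp add: algebra_simps)
      also have "\<dots> \<le> l * (4 * real K * r m) + q * (l * S m * (4 * real K + 1 - real m))"
        using IH(4) q0 by (intro add_left_mono mult_left_mono)
      also have "\<dots> = l * (4 * real K * r m + S m * (q * (4 * real K + 1 - real m)))"
        by (simp add: algebra_simps)
      also have "\<dots> \<le> l * (4 * real K * r m + S m * (4 * real K - 1 - real m))"
        using q_step S0 l by (intro mult_left_mono add_left_mono) auto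
      also have "\<dots> \<le> l * ((S m + r m) * (4 * real K - real m))"
        using S_ge[of m] S0[of m] l by (intro mult_left_mono) (auto simp: algebra_simps)
      finally show ?thesis by (simp add: SS algebra_simps)
    qed
    ultimately show ?case by simp
  qed
  note m = main[OF order_refl w]
  show "0 \<le> \<beta>" using m by simp
  have "real K \<ge> 2" using K by simp
  have lS: "0 \<le> l * S K" using l S0 by simp
  have "4 * real K * \<gamma> \<le> l * S K * (3 * real K + 1)" using m by simp
  also have "\<dots> \<le> l * S K * (7 / 2 * real K)"
    using lS \<open>real K \<ge> 2\<close> by (intro mult_left_mono) auto
  also have "\<dots> = 4 * real K * (7 / 8 * (l * S K))" by simp
  finally have \<gamma>: "\<gamma> \<le> 7 / 8 * (l * S K)" using K by (simp only: mult_le_cancel_left_pos)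
  have "1 - q = p + 2 * l * (1 - p)" by (simp add: q_def algebra_simps)
  also have "\<dots> \<le> p + p * 1" using l p p0 by (intro add_left_mono mult_mono) auto
  finally have "1 - q \<le> 2 * p" by simp
  have "p / 2 * (l * S K / 8) \<le> p / 2 * (l * S K - \<gamma>)"
    using \<gamma> p0 by (intro mult_left_mono) auto
  also have "\<dots> = (1 - q) * \<beta>" using m by simp
  also have "\<dots> \<le> 2 * p * \<beta>" using \<open>1 - q \<le> 2 * p\<close> m by (intro mult_right_mono) auto
  finally have "p * (l * S K) \<le> p * (32 * \<beta>)" by simp
  then have "l * S K \<le> 32 * \<beta>" using p_pos by simp
  then show "1 - \<alpha> \<le> 33 * \<beta>" using m by simp
qed

text \<open>
  The negative part after a step is bounded from below by distinguishing the sample: no jump shrinks the negative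
  part by the curvature on the left, a jump to the left contributes at least the length of the jump
  minus the position, and a jump to the right contributes at least zero.
\<close>

lemma worker_drift:
  fixes b c \<eta> p :: real and t i :: nat and X :: "_ \<Rightarrow> real"
  defines "Z \<equiv> \<lambda>j \<omega>. local_steps (noisy_slope (2 * b) b c) \<eta> (\<lambda>k. \<omega> (t, i, k)) (X \<omega>) j"
  assumes p: "0 \<le> p" "p \<le> 1" and \<eta>b: "0 \<le> \<eta> * b" "\<eta> * b \<le> 1 / 2"
    and X: "bounded_rv p X" and fresh: "\<And>j \<omega> v. X (fun_upd \<omega> (t, i, j) v) = X \<omega>"
  shows "(\<integral>\<omega>. Z (Suc j) \<omega> \<partial>coins p)
      = (1 - \<eta> * b) * (\<integral>\<omega>. Z j \<omega> \<partial>coins p) + \<eta> * b * (\<integral>\<omega>. - min (Z j \<omega>) 0 \<partial>coins p)" (is ?mean)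
    and "(1 - p) * (1 - 2 * (\<eta> * b)) * (\<integral>\<omega>. - min (Z j \<omega>) 0 \<partial>coins p)
        + p / 2 * (\<eta> * c - (\<integral>\<omega>. Z (Suc j) \<omega> \<partial>coins p))
      \<le> (\<integral>\<omega>. - min (Z (Suc j) \<omega>) 0 \<partial>coins p)" (is ?negative_part)
proof -
  interpret prob_space "coins p" by (rule prob_space_coins)
  define l where "l = \<eta> * b"
  have l: "0 \<le> l" "l \<le> 1 / 2" using \<eta>b by (auto simp: l_def)
  let ?a = "(t, i, j)"
  have Z: "bounded_rv p (Z j)" for j unfolding Z_def by (intro bounded_rv_local_steps X)
  have Z_fresh: "Z j (fun_upd \<omega> ?a v) = Z j \<omega>" for \<omega> v
    unfolding Z_def fresh by (rule local_steps_cong) auto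
  define U where "U \<omega> = 0 - min (Z j \<omega>) 0" for \<omega>
  have U: "bounded_rv p U" unfolding U_def by (intro bounded_rv_intros Z)
  define Y where "Y \<omega> = (1 - l) * Z j \<omega> + l * U \<omega>" for \<omega>
  have Y: "bounded_rv p Y" unfolding Y_def by (intro bounded_rv_intros Z U)
  have U_fresh: "U (fun_upd \<omega> ?a v) = U \<omega>" and Y_fresh: "Y (fun_upd \<omega> ?a v) = Y \<omega>" for \<omega> v
    by (simp_all add: U_def Y_def Z_fresh)
  have step: "Z (Suc j) \<omega> = Y \<omega> - \<eta> * c * sgn (\<omega> ?a)" for \<omega>
    by (simp add: Z_def Y_def U_def l_def noisy_slope_def slope_def algebra_simps)
  have noise: "(\<integral>\<omega>. sgn (\<omega> ?a) \<partial>coins p) = 0"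
    using expectation_times_sgn[of p "\<lambda>_. 1" ?a] p by (simp add: bounded_rv_const)
  have "(\<integral>\<omega>. Z (Suc j) \<omega> \<partial>coins p) = (\<integral>\<omega>. Y \<omega> \<partial>coins p) - \<eta> * c * (\<integral>\<omega>. sgn (\<omega> ?a) \<partial>coins p)"
    unfolding step
    by (subst Bochner_Integration.integral_diff integral_mult_right_zero;
        (intro bounded_rv_integrable bounded_rv_intros Y)?)+ (rule refl)
  then have mean_Y: "(\<integral>\<omega>. Z (Suc j) \<omega> \<partial>coins p) = (\<integral>\<omega>. Y \<omega> \<partial>coins p)" by (simp add: noise)
  also have "\<dots> = (1 - l) * (\<integral>\<omega>. Z j \<omega> \<partial>coins p) + l * (\<integral>\<omega>. U \<omega> \<partial>coins p)"
    unfolding Y_def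
    by (subst Bochner_Integration.integral_add integral_mult_right_zero;
        (intro bounded_rv_integrable bounded_rv_intros Z U)?)+ (rule refl)
  finally show ?mean by (simp add: U_def l_def)

  define no_jump where "no_jump \<xi> = (of_bool (\<xi> = 0) :: real)" for \<xi> :: real
  define left_jump where "left_jump \<xi> = (of_bool (\<xi> > 0) :: real)" for \<xi> :: real
  have bounded: "\<bar>no_jump \<xi>\<bar> \<le> 1" "\<bar>left_jump \<xi>\<bar> \<le> 1" for \<xi>
    by (auto simp: no_jump_def left_jump_def)
  have jump_probabilities:
    "(\<integral>\<xi>. no_jump \<xi> \<partial>coin p) = 1 - p" "(\<integral>\<xi>. left_jump \<xi> \<partial>coin p) = p / 2"
    using p by (simp_all add: integral_coin no_jump_def left_jump_def)
  (* Below, U is the negative part before the step and Y the position after the step without its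
     noise; the factor 1 - 2 * l is the contraction on the left side. *)
  have pointwise: "(1 - 2 * l) * (U \<omega> * no_jump (\<omega> ?a)) + (\<eta> * c - Y \<omega>) * left_jump (\<omega> ?a)
      \<le> 0 - min (Z (Suc j) \<omega>) 0" for \<omega>
  proof -
    have "- min (Y \<omega>) 0 = (1 - 2 * l) * U \<omega>"
    proof (cases "Z j \<omega> < 0")
      case True
      then have "Y \<omega> = (1 - 2 * l) * Z j \<omega>" "U \<omega> = - Z j \<omega>" by (auto simp: Y_def U_def algebra_simps)
      moreover have "(1 - 2 * l) * Z j \<omega> \<le> 0" using True l by (intro mult_nonneg_nonpos) auto
      ultimately show ?thesis by simp
    next
      case False
      then show ?thesis using l by (simp add: Y_def U_def)
    qed
    then show ?thesis
      using step[of \<omega>] by (auto simp: no_jump_def left_jump_def sgn_if)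
  qed
  have jumps: "bounded_rv p (\<lambda>\<omega>. no_jump (\<omega> ?a))" "bounded_rv p (\<lambda>\<omega>. left_jump (\<omega> ?a))"
    by (intro bounded_rv_coordinate[OF bounded(1)] bounded_rv_coordinate[OF bounded(2)])+
  have J: "bounded_rv p (\<lambda>\<omega>. \<eta> * c - Y \<omega>)" by (intro bounded_rv_intros Y)
  have mean_J: "(\<integral>\<omega>. \<eta> * c - Y \<omega> \<partial>coins p) = \<eta> * c - (\<integral>\<omega>. Y \<omega> \<partial>coins p)"
    using bounded_rv_integrable[OF Y] by (simp add: prob_space)
  have "(1 - 2 * l) * ((\<integral>\<omega>. U \<omega> \<partial>coins p) * (1 - p)) + (\<eta> * c - (\<integral>\<omega>. Y \<omega> \<partial>coins p)) * (p / 2)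
      = (1 - 2 * l) * (\<integral>\<omega>. U \<omega> * no_jump (\<omega> ?a) \<partial>coins p)
        + (\<integral>\<omega>. (\<eta> * c - Y \<omega>) * left_jump (\<omega> ?a) \<partial>coins p)"
    using expectation_independent_coordinate[of p U no_jump 1 ?a, OF p U bounded(1) U_fresh]
      expectation_independent_coordinate[of p "\<lambda>\<omega>. \<eta> * c - Y \<omega>" left_jump 1 ?a, OF p J bounded(2)]
    by (simp add: Y_fresh jump_probabilities mean_J)
  also have "\<dots> = (\<integral>\<omega>. (1 - 2 * l) * (U \<omega> * no_jump (\<omega> ?a)) + (\<eta> * c - Y \<omega>) * left_jump (\<omega> ?a) \<partial>coins p)"
    by (subst Bochner_Integration.integral_add integral_mult_right_zero;
        (intro bounded_rv_integrable bounded_rv_intros U J jumps)?)+ (rule refl)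
  also have "\<dots> \<le> (\<integral>\<omega>. 0 - min (Z (Suc j) \<omega>) 0 \<partial>coins p)"
    by (intro integral_mono pointwise bounded_rv_integrable bounded_rv_intros U J jumps Z)
  finally show ?negative_part by (simp add: U_def l_def mean_Y algebra_simps)
qed

text \<open>
  The drift inequality of one worker is linear, so it survives averaging over the workers and can
  be iterated over the rounds, whatever the distribution of the common starting point is.
\<close>

lemma mean_drift:
  assumes p: "2 * (\<eta> * b) \<le> p" "p \<le> 1" "1 / real K \<le> p" and \<eta>b: "0 \<le> \<eta> * b"
    and K: "K \<ge> 2" and n: "n \<ge> 1" and x: "0 \<le> x" and c: "0 \<le> \<eta> * c"
  shows "(1 - (1 - \<eta> * b) ^ (K * R)) * (\<eta> * c / 33)
    \<le> (\<integral>\<omega>. local_sgd (noisy_slope (2 * b) b c) n \<eta> K x \<omega> R \<partial>coins p)"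
proof -
  interpret prob_space "coins p" by (rule prob_space_coins)
  define J where "J = \<eta> * c"
  let ?X = "\<lambda>t \<omega>. local_sgd (noisy_slope (2 * b) b c) n \<eta> K x \<omega> t"
  have p0: "0 \<le> p" and \<eta>b': "\<eta> * b \<le> 1 / 2" using p \<eta>b by auto
  obtain \<alpha> \<gamma> \<beta> where w: "drift_weights (\<eta> * b) p K = (\<alpha>, \<gamma>, \<beta>)" by (metis prod_cases3)
  note bounds = drift_weights_bounds[OF \<eta>b \<eta>b' p0 p(2) w]
  note ratio = drift_weights_ratio[OF \<eta>b \<eta>b' p K w]
  have X: "bounded_rv p (?X t)" for t by (rule bounded_rv_local_sgd)
  have round: "\<alpha> * (\<integral>\<omega>. ?X t \<omega> \<partial>coins p) + \<beta> * J \<le> (\<integral>\<omega>. ?X (Suc t) \<omega> \<partial>coins p)" for t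
  proof -
    define Z where "Z i j \<omega> = local_steps (noisy_slope (2 * b) b c) \<eta> (\<lambda>k. \<omega> (t, i, k)) (?X t \<omega>) j"
      for i j \<omega>
    have Z: "bounded_rv p (Z i j)" for i j unfolding Z_def by (intro bounded_rv_local_steps X)
    have worker: "\<alpha> * (\<integral>\<omega>. ?X t \<omega> \<partial>coins p) + \<beta> * J \<le> (\<integral>\<omega>. Z i K \<omega> \<partial>coins p)" for i
    proof -
      have fresh: "?X t (fun_upd \<omega> (t, i, j) v) = ?X t \<omega>" for j \<omega> v by (rule local_sgd_cong) auto
      note drift = worker_drift[where b = b and c = c and t = t and i = i and X = "?X t",
          OF p0 p(2) \<eta>b \<eta>b' X fresh, folded Z_def]
      have "\<alpha> * (\<integral>\<omega>. Z i 0 \<omega> \<partial>coins p) + \<gamma> * (\<integral>\<omega>. - min (Z i 0 \<omega>) 0 \<partial>coins p) + \<beta> * J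
          \<le> (\<integral>\<omega>. Z i (0 + K) \<omega> \<partial>coins p)"
        by (rule drift_weights_lower_bound[OF \<eta>b \<eta>b' p0 p(2) _ _ w])
           (use drift in \<open>simp_all add: J_def\<close>)
      moreover have "0 \<le> \<gamma> * (\<integral>\<omega>. - min (Z i 0 \<omega>) 0 \<partial>coins p)"
        using bounds by (intro mult_nonneg_nonneg integral_nonneg_AE) auto
      ultimately show ?thesis by (simp add: Z_def)
    qed
    have "\<alpha> * (\<integral>\<omega>. ?X t \<omega> \<partial>coins p) + \<beta> * J
        = (1 / real n) * (\<Sum>i<n. \<alpha> * (\<integral>\<omega>. ?X t \<omega> \<partial>coins p) + \<beta> * J)"
      using n by simp
    also have "\<dots> \<le> (1 / real n) * (\<Sum>i<n. \<integral>\<omega>. Z i K \<omega> \<partial>coins p)"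
      using worker by (intro mult_left_mono sum_mono) auto
    also have "(\<Sum>i<n. \<integral>\<omega>. Z i K \<omega> \<partial>coins p) = (\<integral>\<omega>. (\<Sum>i<n. Z i K \<omega>) \<partial>coins p)"
      by (intro Bochner_Integration.integral_sum[symmetric] bounded_rv_integrable Z)
    also have "(1 / real n) * \<dots> = (\<integral>\<omega>. ?X (Suc t) \<omega> \<partial>coins p)"
      by (simp add: Z_def)
    finally show ?thesis .
  qed
  have J: "0 \<le> J" using c by (simp add: J_def)
  have "(1 - \<alpha> ^ R) * (J / 33) \<le> (\<integral>\<omega>. ?X R \<omega> \<partial>coins p)"
  proof (induction R)
    case 0
    show ?case using x by (simp add: prob_space)
  next
    case (Suc t)
    have "(1 - \<alpha> ^ Suc t) * (J / 33) = \<alpha> * ((1 - \<alpha> ^ t) * (J / 33)) + (1 - \<alpha>) * (J / 33)"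
      by (simp add: field_simps)
    also have "\<dots> \<le> \<alpha> * (\<integral>\<omega>. ?X t \<omega> \<partial>coins p) + 33 * \<beta> * (J / 33)"
      using Suc.IH bounds ratio J by (intro add_mono mult_left_mono mult_right_mono) auto
    also have "\<dots> \<le> (\<integral>\<omega>. ?X (Suc t) \<omega> \<partial>coins p)" using round[of t] by simp
    finally show ?case .
  qed
  moreover have "\<alpha> ^ R \<le> (1 - \<eta> * b) ^ (K * R)"
    unfolding power_mult using bounds by (intro power_mono) auto
  then have "(1 - (1 - \<eta> * b) ^ (K * R)) * (J / 33) \<le> (1 - \<alpha> ^ R) * (J / 33)"
    using J by (intro mult_right_mono) auto
  ultimately show ?thesis by (simp add: J_def)
qed

section \<open>From bounds on the step size to bounds on the time\<close>

text \<open>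
  As \<open>(1 - l) * (1 + l) \<le> 1\<close>, Bernoulli's inequality for \<open>1 + l\<close> bounds \<open>(1 - l) ^ N\<close> by
  \<open>1 / (1 + real N * l)\<close>.
\<close>

lemma one_minus_power_ge:
  fixes l :: real
  assumes "0 \<le> l" "l \<le> 1" "1 / 16 \<le> real N * l"
  shows "1 / 17 \<le> 1 - (1 - l) ^ N"
proof -
  have "(1 - l) ^ N * (1 + real N * l) \<le> (1 - l) ^ N * (1 + l) ^ N"
    using assms by (intro mult_left_mono Bernoulli_inequality) auto
  also have "\<dots> = (1 - l * l) ^ N" by (simp add: algebra_simps flip: power_mult_distrib)
  also have "\<dots> \<le> 1" using assms by (intro power_le_one) (auto simp: mult_le_one)
  finally have *: "(1 - l) ^ N * (1 + real N * l) \<le> 1" .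
  have "(1 - l) ^ N * (17 / 16) \<le> (1 - l) ^ N * (1 + real N * l)"
    using assms by (intro mult_left_mono) auto
  then show ?thesis using * by simp
qed

text \<open>
  The two cases are those of the maximum in \<open>drift\<close>: noise relaxes within a round, and local steps
  are as bad as a single worker, or it does not, and the length of a round enters the bound.
\<close>

lemma time_from_step_size_bounds:
  fixes L B \<sigma> \<epsilon> \<tau> h \<eta> :: real and n R K :: nat
  assumes pos: "L > 0" "B > 0" "\<tau> \<ge> 0" "h \<ge> 0" "n \<ge> 1" "\<epsilon> > 0" "\<eta> > 0" "K \<ge> 2"
    and distance: "B\<^sup>2 / (16 * \<epsilon>) \<le> \<eta> * real (K * R)"
    and stable: "\<eta> * L \<le> 2"
    and noise: "\<eta> * \<sigma>\<^sup>2 \<le> 8 * real n * \<epsilon>"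
    and drift: "L * \<eta>\<^sup>2 * \<sigma>\<^sup>2 \<le> 3000000 * \<epsilon> * max (\<eta> * L / 2) (1 / real K)"
  shows "local_sgd_time \<tau> h R K \<ge>
    1 / 10 ^ 12 *
      min (sqrt (\<tau> * h * (L * \<sigma>\<^sup>2 * B ^ 4 / \<epsilon> ^ 3))
             + h * (L * B\<^sup>2 / \<epsilon> + \<sigma>\<^sup>2 * B\<^sup>2 / (real n * \<epsilon>\<^sup>2)))
          (h * (L * B\<^sup>2 / \<epsilon> + \<sigma>\<^sup>2 * B\<^sup>2 / \<epsilon>\<^sup>2))"
proof -
  define N where "N = real (K * R)"
  define T where "T = local_sgd_time \<tau> h R K"
  have N0: "0 \<le> N" by (simp add: N_def)
  have T: "T = \<tau> * real R + h * N" by (simp add: T_def local_sgd_time_def N_def)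
  have hN: "h * N \<le> T" using pos by (simp add: T)
  have d: "B\<^sup>2 \<le> 16 * \<epsilon> * (\<eta> * N)" using distance pos by (simp add: N_def field_simps)
  have smooth: "L * B\<^sup>2 / \<epsilon> \<le> 32 * N"
  proof -
    have "L * B\<^sup>2 \<le> L * (16 * \<epsilon> * (\<eta> * N))" using d pos by (intro mult_left_mono) auto
    also have "\<dots> = (\<eta> * L) * (16 * \<epsilon> * N)" by simp
    also have "\<dots> \<le> 2 * (16 * \<epsilon> * N)" using stable pos N0 by (intro mult_right_mono) auto
    finally show ?thesis using pos by (simp add: field_simps)
  qed
  have variance: "\<sigma>\<^sup>2 * B\<^sup>2 / (c * \<epsilon>\<^sup>2) \<le> C * N"
    if "\<eta> * \<sigma>\<^sup>2 \<le> C / 16 * c * \<epsilon>" "c > 0" for c C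
  proof -
    have "\<sigma>\<^sup>2 * B\<^sup>2 \<le> \<sigma>\<^sup>2 * (16 * \<epsilon> * (\<eta> * N))" using d by (intro mult_left_mono) auto
    also have "\<dots> = (\<eta> * \<sigma>\<^sup>2) * (16 * \<epsilon> * N)" by simp
    also have "\<dots> \<le> (C / 16 * c * \<epsilon>) * (16 * \<epsilon> * N)"
      using that pos N0 by (intro mult_right_mono) auto
    also have "\<dots> = C * N * (c * \<epsilon>\<^sup>2)" by (simp add: power2_eq_square)
    finally show ?thesis using pos that by (simp add: pos_divide_le_eq)
  qed
  have variance_n: "\<sigma>\<^sup>2 * B\<^sup>2 / (real n * \<epsilon>\<^sup>2) \<le> 128 * N"
    using noise pos by (intro variance) auto
  show ?thesis
  proof (cases "1 / real K \<le> \<eta> * L / 2")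
    case True
    have "L * \<eta>\<^sup>2 * \<sigma>\<^sup>2 \<le> 3000000 * \<epsilon> * (\<eta> * L / 2)"
      using drift unfolding max_absorb1[OF True] .
    then have "(L * \<eta>) * (\<eta> * \<sigma>\<^sup>2) \<le> (L * \<eta>) * (24000000 / 16 * 1 * \<epsilon>)"
      by (simp add: power2_eq_square algebra_simps)
    then have "\<eta> * \<sigma>\<^sup>2 \<le> 24000000 / 16 * 1 * \<epsilon>"
      using pos by (simp only: mult_le_cancel_left_pos mult_pos_pos)
    from variance[OF this] have "\<sigma>\<^sup>2 * B\<^sup>2 / \<epsilon>\<^sup>2 \<le> 24000000 * N" by simp
    then have "L * B\<^sup>2 / \<epsilon> + \<sigma>\<^sup>2 * B\<^sup>2 / \<epsilon>\<^sup>2 \<le> 10 ^ 12 * N" using smooth N0 by simp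
    then have "h * (L * B\<^sup>2 / \<epsilon> + \<sigma>\<^sup>2 * B\<^sup>2 / \<epsilon>\<^sup>2) \<le> h * (10 ^ 12 * N)"
      using pos by (intro mult_left_mono)
    also have "\<dots> \<le> 10 ^ 12 * T" using hN by simp
    finally show ?thesis unfolding T_def[symmetric] by (simp add: min_le_iff_disj)
  next
    case False
    then have "\<eta> * L / 2 \<le> 1 / real K" by simp
    from drift[unfolded max_absorb2[OF this]]
    have "L * \<eta>\<^sup>2 * \<sigma>\<^sup>2 \<le> 3000000 * \<epsilon> * (1 / real K)" .
    then have drift_K: "L * \<eta>\<^sup>2 * \<sigma>\<^sup>2 * real K \<le> 3000000 * \<epsilon>" using pos by (simp add: field_simps)
    have "L * \<sigma>\<^sup>2 * B ^ 4 = L * \<sigma>\<^sup>2 * (B\<^sup>2)\<^sup>2" by simp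
    also have "\<dots> \<le> L * \<sigma>\<^sup>2 * (16 * \<epsilon> * (\<eta> * N))\<^sup>2"
      using d pos by (intro mult_left_mono power_mono) auto
    also have "\<dots> = (L * \<eta>\<^sup>2 * \<sigma>\<^sup>2 * real K) * (256 * \<epsilon>\<^sup>2 * (real R * N))"
      by (simp add: N_def power_mult_distrib power2_eq_square)
    also have "\<dots> \<le> (3000000 * \<epsilon>) * (256 * \<epsilon>\<^sup>2 * (real R * N))"
      using drift_K N0 by (intro mult_right_mono) auto
    also have "\<dots> = 768000000 * (real R * N) * \<epsilon> ^ 3"
      by (simp add: power2_eq_square power3_eq_cube)
    finally have "L * \<sigma>\<^sup>2 * B ^ 4 / \<epsilon> ^ 3 \<le> 768000000 * (real R * N)"
      using pos by (simp add: pos_divide_le_eq)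
    then have "\<tau> * h * (L * \<sigma>\<^sup>2 * B ^ 4 / \<epsilon> ^ 3) \<le> \<tau> * h * (768000000 * (real R * N))"
      using pos by (intro mult_left_mono) auto
    also have "\<dots> = 768000000 * ((\<tau> * real R) * (h * N))" by simp
    also have "\<dots> \<le> 768000000 * T\<^sup>2"
    proof -
      have "0 \<le> \<tau> * real R" "0 \<le> h * N" using pos N0 by auto
      then have "(\<tau> * real R) * (h * N) \<le> T * T" unfolding T by (intro mult_mono) auto
      then show ?thesis by (simp add: power2_eq_square)
    qed
    also have "\<dots> \<le> (100000 * T)\<^sup>2" by (simp add: power_mult_distrib)
    finally have "sqrt (\<tau> * h * (L * \<sigma>\<^sup>2 * B ^ 4 / \<epsilon> ^ 3)) \<le> \<bar>100000 * T\<bar>"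
      by (metis real_sqrt_abs real_sqrt_le_mono)
    moreover have T0: "0 \<le> T" unfolding T using pos N0 by auto
    moreover have "h * (L * B\<^sup>2 / \<epsilon> + \<sigma>\<^sup>2 * B\<^sup>2 / (real n * \<epsilon>\<^sup>2)) \<le> h * (160 * N)"
      using smooth variance_n pos by (intro mult_left_mono) auto
    moreover have "h * (160 * N) \<le> 160 * T" using hN by simp
    ultimately have "sqrt (\<tau> * h * (L * \<sigma>\<^sup>2 * B ^ 4 / \<epsilon> ^ 3))
             + h * (L * B\<^sup>2 / \<epsilon> + \<sigma>\<^sup>2 * B\<^sup>2 / (real n * \<epsilon>\<^sup>2)) \<le> 10 ^ 12 * T" by simp
    then show ?thesis unfolding T_def[symmetric] by (simp add: min_le_iff_disj)
  qed
qed

theorem theorem2p1: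
  fixes L B \<sigma> \<epsilon> \<tau> h \<eta> :: real and n R K :: nat
  assumes "L > 0" "B > 0" "\<sigma> \<ge> 0" "\<tau> \<ge> 0" "h \<ge> 0" "n \<ge> 1"
    and "0 < \<epsilon>" "\<epsilon> \<le> L * B\<^sup>2 / 4"
    and "\<eta> > 0" "K \<ge> 2"
    and solves:
      "\<And>(D :: real measure) (f :: 'a::euclidean_space \<Rightarrow> real) gradf F G x0 xstar.
         stochastic_convex_problem D L B \<sigma> f gradf F G x0 xstar \<Longrightarrow>
         eps_solution (sample_space D) f xstar \<epsilon> (\<lambda>\<omega>. local_sgd G n \<eta> K x0 \<omega> R)"
  shows "local_sgd_time \<tau> h R K \<ge>
    1 / 10 ^ 12 *
      min (sqrt (\<tau> * h * (L * \<sigma>\<^sup>2 * B ^ 4 / \<epsilon> ^ 3))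
             + h * (L * B\<^sup>2 / \<epsilon> + \<sigma>\<^sup>2 * B\<^sup>2 / (real n * \<epsilon>\<^sup>2)))
          (h * (L * B\<^sup>2 / \<epsilon> + \<sigma>\<^sup>2 * B\<^sup>2 / \<epsilon>\<^sup>2))"
proof -
  note params = assms(1-10)
  obtain e :: 'a where e: "e \<in> Basis" using nonempty_Basis by blast
  have "e \<bullet> e = 1" using e by simp
  (* The family of instances, with the vector-valued algorithm reduced to its only moving coordinate. *)
  have hard: "b / 2 * (\<integral>\<omega>. (local_sgd (noisy_slope a b c) n \<eta> K B \<omega> R)\<^sup>2 \<partial>coins p) \<le> \<epsilon>"
    if ab: "0 < b" "b \<le> a" "a \<le> L" and p: "0 < p" "p \<le> 1" and c: "c\<^sup>2 * p = \<sigma>\<^sup>2" for a b c p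
  proof -
    let ?X = "\<lambda>\<omega>. local_sgd (noisy_slope a b c) n \<eta> K B \<omega> R"
    have X: "bounded_rv p ?X" by (rule bounded_rv_local_sgd)
    have "eps_solution (coins p) (\<lambda>x. loss a b (x \<bullet> e)) 0 \<epsilon>
        (\<lambda>\<omega>. local_sgd (\<lambda>x \<xi>. noisy_slope a b c (x \<bullet> e) \<xi> *\<^sub>R e) n \<eta> K (B *\<^sub>R e) \<omega> R)"
      by (rule solves[OF hard_problem[OF e ab assms(2) p c]])
    then have sol: "integrable (coins p) (\<lambda>\<omega>. loss a b (?X \<omega>))"
      "(\<integral>\<omega>. loss a b (?X \<omega>) \<partial>coins p) \<le> \<epsilon>"
      using \<open>e \<bullet> e = 1\<close> by (simp_all add: eps_solution_def local_sgd_inner[OF e] loss_def)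
    have "b / 2 * (\<integral>\<omega>. (?X \<omega>)\<^sup>2 \<partial>coins p) = (\<integral>\<omega>. b / 2 * (?X \<omega>)\<^sup>2 \<partial>coins p)" by simp
    also have "\<dots> \<le> (\<integral>\<omega>. loss a b (?X \<omega>) \<partial>coins p)"
      using ab unfolding power2_eq_square
      by (intro integral_mono bounded_rv_integrable bounded_rv_intros X sol)
         (use loss_ge_square in \<open>auto simp: power2_eq_square\<close>)
    finally show ?thesis using sol by simp
  qed

  define N where "N = K * R"
  define v where "v \<mu> = ((\<lambda>v. (1 - \<eta> * \<mu>)\<^sup>2 * v + \<eta>\<^sup>2 * \<sigma>\<^sup>2 / real n) ^^ N) (B\<^sup>2)" for \<mu>
  have quadratic: "\<mu> / 2 * v \<mu> \<le> \<epsilon>" if "0 < \<mu>" "\<mu> \<le> L" for \<mu>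
    using hard[of \<mu> \<mu> 1 \<sigma>] that second_moment_quadratic[of 1 n \<mu> \<sigma> \<eta> K B R] assms(6)
    by (simp add: v_def N_def)
  have contraction: "((1 - \<eta> * \<mu>)\<^sup>2) ^ N \<le> 1 / 2" if "0 < \<mu>" "\<mu> \<le> L" "4 * \<epsilon> \<le> \<mu> * B\<^sup>2" for \<mu>
  proof -
    have "((1 - \<eta> * \<mu>)\<^sup>2) ^ N * B\<^sup>2 \<le> v \<mu>" unfolding v_def by (rule affine_iterate) auto
    then have "\<mu> / 2 * (((1 - \<eta> * \<mu>)\<^sup>2) ^ N * B\<^sup>2) \<le> \<mu> / 2 * v \<mu>"
      using that by (intro mult_left_mono) auto
    also have "\<dots> \<le> \<mu> / 2 * (1 / 2 * B\<^sup>2)" using quadratic[OF that(1,2)] that(3) by simp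
    finally show ?thesis using that assms(2) by simp
  qed

  have \<epsilon>L: "4 * \<epsilon> \<le> L * B\<^sup>2" using params by simp
  note stable = contraction_needs_steps(1)[OF _ contraction[OF assms(1) order_refl \<epsilon>L]]
  have stable: "\<eta> * L < 2" using params stable by simp

  (* With this curvature the loss at the starting point is 2 * \<epsilon>, so the squared distance has to be
     halved at least. *)
  define \<mu> where "\<mu> = 4 * \<epsilon> / B\<^sup>2"
  have \<mu>: "0 < \<mu>" "\<mu> \<le> L" "\<mu> * B\<^sup>2 = 4 * \<epsilon>" using params by (auto simp: \<mu>_def field_simps)
  define Q where "Q = (1 - \<eta> * \<mu>)\<^sup>2"
  have Q: "Q ^ N \<le> 1 / 2" unfolding Q_def using \<mu> by (intro contraction) auto
  have "1 / 4 \<le> real N * (\<eta> * \<mu>)"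
    using Q \<mu> params unfolding Q_def by (intro contraction_needs_steps) auto
  then have distance: "B\<^sup>2 / (16 * \<epsilon>) \<le> \<eta> * real N"
    using params by (simp add: \<mu>_def field_simps)

  have noise: "\<eta> * \<sigma>\<^sup>2 \<le> 8 * real n * \<epsilon>"
  proof -
    define W where "W = \<eta>\<^sup>2 * \<sigma>\<^sup>2 / real n"
    have W0: "0 \<le> W" by (simp add: W_def)
    have Q1: "Q < 1"
      using Q one_le_power[of Q N] by linarith
    have "W * (1 / 2) \<le> W * (1 - Q ^ N)" using Q W0 by (intro mult_left_mono) auto
    also have "\<dots> \<le> W * (1 - Q ^ N) + Q ^ N * ((1 - Q) * B\<^sup>2)"
      using Q1 by (simp add: Q_def)
    also have "\<dots> = (1 - Q) * v \<mu>"
      using affine_iterate(2)[of Q W N "B\<^sup>2"] W0 by (simp add: Q_def v_def W_def)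
    also have "\<dots> \<le> (1 - Q) * (B\<^sup>2 / 2)"
    proof (rule mult_left_mono)
      have "\<mu> * v \<mu> \<le> \<mu> * (B\<^sup>2 / 2)" using quadratic[OF \<mu>(1,2)] \<mu>(3) by simp
      then show "v \<mu> \<le> B\<^sup>2 / 2" using \<mu>(1) by (simp only: mult_le_cancel_left_pos)
    qed (use Q1 in simp)
    also have "\<dots> \<le> (2 * (\<eta> * \<mu>)) * (B\<^sup>2 / 2)"
      using params \<mu>(1) by (intro mult_right_mono) (auto simp: Q_def power2_eq_square algebra_simps)
    also have "\<dots> = 4 * \<eta> * \<epsilon>" using \<mu>(3) by simp
    finally have "\<eta> * (\<eta> * \<sigma>\<^sup>2) \<le> \<eta> * (8 * real n * \<epsilon>)"
      using assms(6) by (simp add: W_def field_simps power2_eq_square)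
    then show ?thesis using params by simp
  qed

  have drift: "L * \<eta>\<^sup>2 * \<sigma>\<^sup>2 \<le> 3000000 * \<epsilon> * max (\<eta> * L / 2) (1 / real K)"
  proof -
    (* Only half of the available curvature is used: as \<eta> * L < 2, this makes \<eta> times the curvature
       on the left at most 1, so that a step without noise never crosses the origin. *)
    define b where "b = L / 4"
    define p where "p = max (\<eta> * L / 2) (1 / real K)"
    define c where "c = \<sigma> / sqrt p"
    have p_ge: "\<eta> * L / 2 \<le> p" "1 / real K \<le> p" by (simp_all add: p_def)
    have "0 < 1 / real K" "1 / real K \<le> 1" using params by auto
    then have p: "0 < p" "p \<le> 1" "2 * (\<eta> * b) \<le> p" "1 / real K \<le> p"
      using p_ge stable by (linarith, simp add: p_def, simp_all add: b_def mult.commute)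
    have c: "c\<^sup>2 * p = \<sigma>\<^sup>2" "0 \<le> c" using p params by (auto simp: c_def power_divide)
    have \<eta>b: "0 \<le> \<eta> * b" "\<eta> * b \<le> 1" using params stable by (auto simp: b_def)
    let ?X = "\<lambda>\<omega>. local_sgd (noisy_slope (2 * b) b c) n \<eta> K B \<omega> R"
    interpret prob_space "coins p" by (rule prob_space_coins)
    have X: "bounded_rv p ?X" by (rule bounded_rv_local_sgd)
    have "1 / 16 \<le> real N * (\<eta> * b)"
    proof -
      have "1 / 16 \<le> b * (B\<^sup>2 / (16 * \<epsilon>))" using params by (simp add: b_def field_simps)
      also have "\<dots> \<le> b * (\<eta> * real N)" using distance params by (intro mult_left_mono) (auto simp: b_def)
      finally show ?thesis by (simp add: algebra_simps)
    qed
    then have "1 / 17 \<le> 1 - (1 - \<eta> * b) ^ (K * R)"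
      using one_minus_power_ge[OF \<eta>b] by (simp add: N_def)
    then have "1 / 17 * (\<eta> * c / 33) \<le> (1 - (1 - \<eta> * b) ^ (K * R)) * (\<eta> * c / 33)"
      using params c by (intro mult_right_mono) auto
    also have "\<dots> \<le> expectation ?X"
      using params c by (intro mean_drift p \<eta>b) auto
    (* 561 = 17 * 33, and 8 * 561\<^sup>2 is at most 3000000. *)
    finally have "(\<eta> * c / 561)\<^sup>2 \<le> (expectation ?X)\<^sup>2"
      using params c by (intro power_mono) auto
    also have "\<dots> \<le> expectation (\<lambda>\<omega>. (?X \<omega>)\<^sup>2)"
      using variance_positive[of ?X] bounded_rv_integrable[OF X]
        bounded_rv_integrable[OF bounded_rv_mult[OF X X]]
      by (subst (asm) variance_eq) (auto simp: power2_eq_square)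
    finally have "b / 2 * (\<eta> * c / 561)\<^sup>2 \<le> b / 2 * expectation (\<lambda>\<omega>. (?X \<omega>)\<^sup>2)"
      using params by (intro mult_left_mono) (auto simp: b_def)
    also have "\<dots> \<le> \<epsilon>" using params p c by (intro hard) (auto simp: b_def)
    finally have "L * \<eta>\<^sup>2 * c\<^sup>2 \<le> 3000000 * \<epsilon>"
      using params by (simp add: b_def power_divide power_mult_distrib)
    then have "L * \<eta>\<^sup>2 * c\<^sup>2 * p \<le> 3000000 * \<epsilon> * p" using p by (intro mult_right_mono) auto
    then show ?thesis using c by (simp add: mult.assoc p_def)
  qed

  show ?thesis
    by (rule time_from_step_size_bounds)
       (use params distance stable noise drift in \<open>auto simp: N_def\<close>)
qed

end
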